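(* Let $G$ be a finite graph and let $\mathcal{T}$ be a tree-cut decomposition of $G$. Then: (i) if $\mathcal{T}$ has GPRTW's width $k$, then $\mathcal{T}$ has adhesion-width $\leq k^2$ and bag-width $\leq k$; (ii) if $\mathcal{T}$ has adhesion-width $a$ and bag-width $b$, then $\mathcal{T}$ has GPRTW's width $\leq a+b+2$.
   Context: Graphs are finite and undirected; parallel edges are allowed, loops are not. A near-partition of a set $\Omega$ is a family of pairwise disjoint (possibly empty) subsets of $\Omega$ with union $\Omega$. A tree-cut decomposition of $G$ is a pair $\mathcal{T}=(T,\mathcal{X})$ where $T$ is a tree and $\mathcal{X}=\{X_t : t\in V(T)\}$ is a near-partition of $V(G)$ indexed by the nodes of $T$; $X_t$ is the bag of $t$. For an edge $st$ of $T$, $\mathrm{adh}(st)$ is the set of edges $uv$ of $G$ such that the node whose bag contains $u$ and the node whose bag contains $v$ lie in different components of $T-st$. The edge $st$ is bold if $|\mathrm{adh}(st)|\geq 3$ and thin otherwise. For a node $t$, $\mathrm{adh}(t)$ is the union of the sets $\mathrm{adh}(st)$ over all bold edges $st$ of $T$ incident to $t$. The adhesion-width of $\mathcal{T}$ is $\max_{t\in V(T)}|\mathrm{adh}(t)|$ and the bag-width of $\mathcal{T}$ is $\max_{t\in V(T)}|X_t|$. For a node $t$ of $T$ let $w_t := |X_t| + |\{t'\in N_T(t) : |\mathrm{adh}(tt')|\geq 3\}|$, where $N_T(t)$ is the set of neighbors of $t$ in $T$. The GPRTW's width of $\mathcal{T}$ is $\max\left(\{|\mathrm{adh}(e)| :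 e\in E(T)\}\cup\{w_t : t\in V(T)\}\right)$. *)

theory Defs
  imports Main "HOL-Library.Disjoint_Sets"
begin

text \<open>
  Undirected multigraphs: edges are abstract objects, so that parallel edges are distinct elements
  of \<open>edges\<close>; every edge has exactly two ends, so that there are no loops.
\<close>

record ('v, 'e) mgraph =
  verts :: "'v set"
  edges :: "'e set"
  ends :: "'e \<Rightarrow> 'v set"

definition finite_mgraph :: "('v, 'e) mgraph \<Rightarrow> bool" where
  "finite_mgraph G \<longleftrightarrow> finite (verts G) \<and> finite (edges G) \<and>
     (\<forall>e\<in>edges G. ends G e \<subseteq> verts G \<and> card (ends G e) = 2)"

definition neighbors :: "('v, 'e) mgraph \<Rightarrow> 'v \<Rightarrow> 'v set" where
  "neighbors G u = {v. \<exists>e\<in>edges G. ends G e = {u, v}}"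

definition component_of :: "('v, 'e) mgraph \<Rightarrow> 'v \<Rightarrow> 'v set" where
  "component_of G u = {v \<in> verts G. (u, v) \<in> {(x, y). y \<in> neighbors G x}\<^sup>*}"

definition connected_mgraph :: "('v, 'e) mgraph \<Rightarrow> bool" where
  "connected_mgraph G \<longleftrightarrow> verts G \<noteq> {} \<and> (\<forall>u\<in>verts G. component_of G u = verts G)"

text \<open>Two parallel edges form a cycle of length 2.\<close>

definition is_cycle :: "('v, 'e) mgraph \<Rightarrow> 'v list \<Rightarrow> 'e list \<Rightarrow> bool" where
  "is_cycle G vs es \<longleftrightarrow> length vs = length es \<and> 2 \<le> length es \<and> distinct vs \<and> distinct es \<and>
     (\<forall>i<length es. es ! i \<in> edges G \<and>
        ends G (es ! i) = {vs ! i, vs ! (Suc i mod length es)})"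

definition is_tree :: "('v, 'e) mgraph \<Rightarrow> bool" where
  "is_tree T \<longleftrightarrow> finite_mgraph T \<and> connected_mgraph T \<and> (\<nexists>vs es. is_cycle T vs es)"

definition del_edge :: "('v, 'e) mgraph \<Rightarrow> 'e \<Rightarrow> ('v, 'e) mgraph" where
  "del_edge G e = G\<lparr>edges := edges G - {e}\<rparr>"

definition near_partition_on :: "'a set \<Rightarrow> 'i set \<Rightarrow> ('i \<Rightarrow> 'a set) \<Rightarrow> bool" where
  "near_partition_on \<Omega> I X \<longleftrightarrow> disjoint_family_on X I \<and> (\<Union>i\<in>I. X i) = \<Omega>"

definition tree_cut_decomposition ::
  "('v, 'e) mgraph \<Rightarrow> ('t, 'f) mgraph \<Rightarrow> ('t \<Rightarrow> 'v set) \<Rightarrow> bool" where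
  "tree_cut_decomposition G T X \<longleftrightarrow> is_tree T \<and> near_partition_on (verts G) (verts T) X"

definition adh_edge ::
  "('v, 'e) mgraph \<Rightarrow> ('t, 'f) mgraph \<Rightarrow> ('t \<Rightarrow> 'v set) \<Rightarrow> 'f \<Rightarrow> 'e set" where
  "adh_edge G T X f = {e \<in> edges G. \<exists>u v. ends G e = {u, v} \<and>
     (\<exists>s\<in>verts T. \<exists>t\<in>verts T. u \<in> X s \<and> v \<in> X t \<and>
        component_of (del_edge T f) s \<noteq> component_of (del_edge T f) t)}"

definition bold ::
  "('v, 'e) mgraph \<Rightarrow> ('t, 'f) mgraph \<Rightarrow> ('t \<Rightarrow> 'v set) \<Rightarrow> 'f \<Rightarrow> bool" where
  "bold G T X f \<longleftrightarrow> 3 \<le> card (adh_edge G T X f)"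

definition adh_node ::
  "('v, 'e) mgraph \<Rightarrow> ('t, 'f) mgraph \<Rightarrow> ('t \<Rightarrow> 'v set) \<Rightarrow> 't \<Rightarrow> 'e set" where
  "adh_node G T X t = (\<Union>f\<in>{f \<in> edges T. t \<in> ends T f \<and> bold G T X f}. adh_edge G T X f)"

definition adhesion_width ::
  "('v, 'e) mgraph \<Rightarrow> ('t, 'f) mgraph \<Rightarrow> ('t \<Rightarrow> 'v set) \<Rightarrow> nat" where
  "adhesion_width G T X = Max ((\<lambda>t. card (adh_node G T X t)) ` verts T)"

definition bag_width :: "('t, 'f) mgraph \<Rightarrow> ('t \<Rightarrow> 'v set) \<Rightarrow> nat" where
  "bag_width T X = Max ((\<lambda>t. card (X t)) ` verts T)"

text \<open>In a tree, the edge joining \<open>t\<close> and its neighbor \<open>t'\<close> is unique.\<close>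

definition node_weight ::
  "('v, 'e) mgraph \<Rightarrow> ('t, 'f) mgraph \<Rightarrow> ('t \<Rightarrow> 'v set) \<Rightarrow> 't \<Rightarrow> nat" where
  "node_weight G T X t = card (X t) +
     card {t' \<in> neighbors T t.
       \<exists>f\<in>edges T. ends T f = {t, t'} \<and> 3 \<le> card (adh_edge G T X f)}"

definition gprtw_width ::
  "('v, 'e) mgraph \<Rightarrow> ('t, 'f) mgraph \<Rightarrow> ('t \<Rightarrow> 'v set) \<Rightarrow> nat" where
  "gprtw_width G T X =
     Max ((\<lambda>f. card (adh_edge G T X f)) ` edges T \<union> node_weight G T X ` verts T)"

end

theory Submission
  imports Defs
begin

text \<open>
  For (i), \<open>adh(t)\<close> is a union of at most \<open>k\<close> sets of size at most \<open>k\<close>, since parallel edges would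
  be a cycle of the tree. For (ii), every edge of \<open>G\<close> lies in \<open>adh(f)\<close> for at most two tree edges
  \<open>f\<close> incident to \<open>t\<close>: deleting \<open>f\<close> must separate one of its two end nodes from \<open>t\<close>, and a node is
  separated from \<open>t\<close> by at most one such \<open>f\<close>. Double counting then shows that the number \<open>m\<close> of bold
  edges at \<open>t\<close> satisfies \<open>3m \<le> 2|adh(t)|\<close>.
\<close>

section \<open>Components and deletion of one edge\<close>

lemma neighbors_sym: "y \<in> neighbors G x \<longleftrightarrow> x \<in> neighbors G y"
  by (auto simp: neighbors_def insert_commute)

text \<open>Adjacency is symmetric, so reachability is an equivalence relation and nodes reachable
  from each other reach the same vertices.\<close>

lemma component_of_eq:
  assumes "s \<in> component_of G t"
  shows "component_of G s = component_of G t"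
proof -
  let ?r = "{(x, y). y \<in> neighbors G x}"
  have "sym ?r"
    by (auto simp: sym_def neighbors_sym)
  then have "sym (?r\<^sup>*)"
    by (rule sym_rtrancl)
  moreover have "(t, s) \<in> ?r\<^sup>*"
    using assms by (simp add: component_of_def)
  ultimately have "(s, v) \<in> ?r\<^sup>* \<longleftrightarrow> (t, v) \<in> ?r\<^sup>*" for v
    by (meson rtrancl_trans symD)
  then show ?thesis
    by (simp add: component_of_def)
qed

lemma verts_del_edge [simp]: "verts (del_edge G f) = verts G"
  by (simp add: del_edge_def)

lemma neighbors_del_edgeI:
  assumes "h \<in> edges G" "ends G h = {x, y}" "h \<noteq> f"
  shows "y \<in> neighbors (del_edge G f) x"
  using assms by (auto simp: neighbors_def del_edge_def)

text \<open>
  After its last visit to \<open>t\<close>, a walk from \<open>t\<close> uses only one edge incident to \<open>t\<close>.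
\<close>

lemma reachable_del_edge_or:
  assumes "(t, s) \<in> {(x, y). y \<in> neighbors T x}\<^sup>*"
    and "t \<in> ends T f" "t \<in> ends T g" "f \<noteq> g"
  shows "(t, s) \<in> {(x, y). y \<in> neighbors (del_edge T f) x}\<^sup>* \<or>
         (t, s) \<in> {(x, y). y \<in> neighbors (del_edge T g) x}\<^sup>*"
  using assms(1)
proof (induction rule: rtrancl_induct)
  case base
  show ?case by simp
next
  case (step x y)
  obtain h where h: "h \<in> edges T" "ends T h = {x, y}"
    using step.hyps(2) by (auto simp: neighbors_def)
  have nb: "y \<in> neighbors (del_edge T q) x" if "h \<noteq> q" for q
    using h that by (rule neighbors_del_edgeI)
  show ?case
  proof (cases "y = t")
    case True
    then show ?thesis by simp
  next
    case y: False
    show ?thesis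
    proof (cases "x = t")
      case True
      \<comment> \<open>The walk so far is discarded: the single edge \<open>h\<close> leads from
        \<open>t\<close> to \<open>y\<close> and survives in at least one of the two graphs.\<close>
      have "h \<noteq> f \<or> h \<noteq> g" using assms(4) by blast
      then show ?thesis
        using nb True by (metis (mono_tags, lifting) case_prodI mem_Collect_eq r_into_rtrancl)
    next
      case False
      \<comment> \<open>Here \<open>h\<close> misses \<open>t\<close>, so it survives both deletions
        and extends whichever walk the induction hypothesis provides.\<close>
      then have "h \<noteq> f" "h \<noteq> g"
        using y h assms(2,3) by auto
      then show ?thesis
        using nb step.IH
        by (metis (mono_tags, lifting) case_prodI mem_Collect_eq rtrancl.rtrancl_into_rtrancl)
    qed
  qed
qed

text \<open>Of two distinct edges at \<open>t\<close>, at least one can be deleted while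
  \<open>s\<close> stays reachable from \<open>t\<close>, so they cannot both separate
  \<open>s\<close> from \<open>t\<close>.\<close>

lemma card_separating_edges_le_1:
  assumes "connected_mgraph T" "s \<in> verts T" "t \<in> verts T"
    and "\<And>f. f \<in> B \<Longrightarrow> t \<in> ends T f"
  shows "card {f \<in> B. s \<notin> component_of (del_edge T f) t} \<le> 1"
proof -
  have reach: "(t, s) \<in> {(x, y). y \<in> neighbors T x}\<^sup>*"
    using assms(1-3) by (auto simp: connected_mgraph_def component_of_def)
  have "f = g" if "f \<in> {f \<in> B. s \<notin> component_of (del_edge T f) t}"
    "g \<in> {f \<in> B. s \<notin> component_of (del_edge T f) t}" for f g
    using reachable_del_edge_or[OF reach, of f g] that assms(2,4)
    by (auto simp: component_of_def)
  then show ?thesis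
    \<comment> \<open>An infinite set has \<open>card\<close> equal to 0; for a finite one the bound
      says that any two elements agree.\<close>
    by (cases "finite {f \<in> B. s \<notin> component_of (del_edge T f) t}")
      (auto simp: card_le_Suc0_iff_eq)
qed

section \<open>Bold edges at a node of a tree\<close>

lemma tree_no_parallel:
  assumes "is_tree T" "f \<in> edges T" "g \<in> edges T" "ends T f = ends T g"
  shows "f = g"
proof (rule ccontr)
  assume "f \<noteq> g"
  have "card (ends T f) = 2"
    using assms by (auto simp: is_tree_def finite_mgraph_def)
  then obtain x y where xy: "ends T f = {x, y}" "x \<noteq> y"
    by (auto simp: card_2_iff)
  have "is_cycle T [x, y] [f, g]"
    using xy assms \<open>f \<noteq> g\<close> by (auto simp: is_cycle_def less_Suc_eq)
  then show False
    using assms(1) by (auto simp: is_tree_def)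
qed

text \<open>The index set of the union in \<open>adh_node\<close>, named so that its elements can be
  counted.\<close>

definition bold_star ::
  "('v, 'e) mgraph \<Rightarrow> ('t, 'f) mgraph \<Rightarrow> ('t \<Rightarrow> 'v set) \<Rightarrow> 't \<Rightarrow> 'f set" where
  "bold_star G T X t = {f \<in> edges T. t \<in> ends T f \<and> bold G T X f}"

lemma adh_node_eq_UN: "adh_node G T X t = (\<Union>f\<in>bold_star G T X t. adh_edge G T X f)"
  by (simp add: adh_node_def bold_star_def)

lemma finite_bold_star: "is_tree T \<Longrightarrow> finite (bold_star G T X t)"
  by (simp add: bold_star_def is_tree_def finite_mgraph_def)

lemma finite_adh_node:
  assumes "finite_mgraph G"
  shows "finite (adh_node G T X t)"
proof (rule finite_subset)
  show "adh_node G T X t \<subseteq> edges G"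
    by (auto simp: adh_node_def adh_edge_def)
  show "finite (edges G)"
    using assms by (simp add: finite_mgraph_def)
qed

text \<open>In a tree an edge at \<open>t\<close> is determined by its other end. Instead of
  choosing that end, the proof sends bold edges \<open>f\<close> to \<open>ends T f\<close> and
  neighbors \<open>t'\<close> to \<open>{t, t'}\<close>: both maps are injective, with the same
  image.\<close>

lemma node_weight_eq:
  assumes "is_tree T"
  shows "node_weight G T X t = card (X t) + card (bold_star G T X t)"
proof -
  let ?N = "{t' \<in> neighbors T t. \<exists>f\<in>edges T. ends T f = {t, t'} \<and> 3 \<le> card (adh_edge G T X f)}"
  have two: "card (ends T f) = 2" if "f \<in> edges T" for f
    using assms that by (auto simp: is_tree_def finite_mgraph_def)
  have inj: "inj_on (ends T) (bold_star G T X t)"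
    by (rule inj_onI) (auto simp: bold_star_def intro: tree_no_parallel[OF assms])
  have "ends T ` bold_star G T X t = (\<lambda>t'. {t, t'}) ` ?N"
  proof (intro equalityI subsetI)
    fix A assume "A \<in> ends T ` bold_star G T X t"
    then obtain f where f: "f \<in> edges T" "t \<in> ends T f" "bold G T X f" "A = ends T f"
      by (auto simp: bold_star_def)
    then obtain t' where "ends T f = {t, t'}"
      using two[OF f(1)] by (metis card_2_iff doubleton_eq_iff f(2) insertE singletonD)
    then show "A \<in> (\<lambda>t'. {t, t'}) ` ?N"
      using f by (auto simp: neighbors_def bold_def)
  next
    fix A assume "A \<in> (\<lambda>t'. {t, t'}) ` ?N"
    then obtain t' f where "f \<in> edges T" "ends T f = {t, t'}" "bold G T X f" "A = {t, t'}"
      by (auto simp: bold_def)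
    then have "f \<in> bold_star G T X t" "A = ends T f"
      by (auto simp: bold_star_def)
    then show "A \<in> ends T ` bold_star G T X t"
      by blast
  qed
  moreover have "inj_on (\<lambda>t'. {t, t'}) ?N"
    by (auto simp: inj_on_def doubleton_eq_iff)
  ultimately have "card (bold_star G T X t) = card ?N"
    using inj by (metis (no_types, lifting) card_image)
  then show ?thesis
    by (simp add: node_weight_def)
qed

section \<open>Double counting of edges crossing the bold edges at a node\<close>

lemma card_crossing_bold_star_le_2:
  assumes "tree_cut_decomposition G T X" "t \<in> verts T"
  shows "card {f \<in> bold_star G T X t. e \<in> adh_edge G T X f} \<le> 2"
proof (cases "\<exists>f. e \<in> adh_edge G T X f")
  case False
  then show ?thesis by simp
next
  case True
  let ?B = "bold_star G T X t"
  have tree: "is_tree T" and disj: "disjoint_family_on X (verts T)"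
    using assms(1) by (auto simp: tree_cut_decomposition_def near_partition_on_def)
  \<comment> \<open>The nodes \<open>p\<close> and \<open>q\<close> come from one arbitrary
    \<open>f\<close>. As the bags are disjoint, every other \<open>f\<close> yields the same two
    nodes, possibly swapped.\<close>
  from True obtain u v p q where
    e: "ends G e = {u, v}" "p \<in> verts T" "q \<in> verts T" "u \<in> X p" "v \<in> X q"
    by (auto simp: adh_edge_def)
  have bag_unique: "i = j" if "i \<in> verts T" "j \<in> verts T" "x \<in> X i" "x \<in> X j" for i j x
    using disj that by (auto simp: disjoint_family_on_def)
  let ?S = "\<lambda>s. {f \<in> ?B. s \<notin> component_of (del_edge T f) t}"
  have "{f \<in> ?B. e \<in> adh_edge G T X f} \<subseteq> ?S p \<union> ?S q"
  proof
    fix f assume f: "f \<in> {f \<in> ?B. e \<in> adh_edge G T X f}"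
    then obtain u' v' p' q' where
      e': "ends G e = {u', v'}" "p' \<in> verts T" "q' \<in> verts T" "u' \<in> X p'" "v' \<in> X q'"
      "component_of (del_edge T f) p' \<noteq> component_of (del_edge T f) q'"
      unfolding adh_edge_def by blast
    have "{u', v'} = {u, v}"
      using e e' by simp
    then have "p' = p \<and> q' = q \<or> p' = q \<and> q' = p"
      using e e' bag_unique by (metis doubleton_eq_iff)
    then have "component_of (del_edge T f) p \<noteq> component_of (del_edge T f) q"
      using e'(6) by auto
    \<comment> \<open>If both nodes lay in the component of \<open>t\<close>, their components would
      coincide.\<close>
    then have "p \<notin> component_of (del_edge T f) t \<or> q \<notin> component_of (del_edge T f) t"
      by (metis component_of_eq)
    then show "f \<in> ?S p \<union> ?S q"
      using f by auto
  qed
  moreover have fin: "finite (?S p \<union> ?S q)"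
    using finite_bold_star[OF tree, of G X t] by simp
  ultimately have "card {f \<in> ?B. e \<in> adh_edge G T X f} \<le> card (?S p \<union> ?S q)"
    by (rule card_mono[rotated])
  also have "\<dots> \<le> card (?S p) + card (?S q)"
    by (rule card_Un_le)
  also have "\<dots> \<le> 1 + 1"
    using tree e assms(2)
    by (intro add_mono card_separating_edges_le_1) (auto simp: is_tree_def bold_star_def)
  finally show ?thesis by simp
qed

lemma card_bold_star_le:
  assumes "finite_mgraph G" "tree_cut_decomposition G T X" "t \<in> verts T"
  shows "3 * card (bold_star G T X t) \<le> 2 * card (adh_node G T X t)"
proof -
  let ?B = "bold_star G T X t" and ?A = "adh_node G T X t"
  have finB: "finite ?B"
    using assms(2) by (auto simp: tree_cut_decomposition_def intro: finite_bold_star)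
  have finA: "finite ?A"
    using assms(1) by (rule finite_adh_node)
  have "3 * card ?B = (\<Sum>f\<in>?B. 3)"
    by simp
  also have "\<dots> \<le> (\<Sum>f\<in>?B. card (adh_edge G T X f))"
    by (rule sum_mono) (simp add: bold_star_def bold_def)
  \<comment> \<open>Every \<open>adh_edge G T X f\<close> with \<open>f\<close> in \<open>?B\<close>
    lies inside \<open>?A\<close>; writing it as a filtered \<open>?A\<close> allows the two sums to
    be exchanged.\<close>
  also have "\<dots> = (\<Sum>f\<in>?B. card {e \<in> ?A. e \<in> adh_edge G T X f})"
    by (intro sum.cong refl arg_cong[of _ _ card]) (auto simp: adh_node_eq_UN)
  also have "\<dots> = (\<Sum>f\<in>?B. \<Sum>e | e \<in> ?A \<and> e \<in> adh_edge G T X f. 1)"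
    by simp
  also have "\<dots> = (\<Sum>e\<in>?A. \<Sum>f | f \<in> ?B \<and> e \<in> adh_edge G T X f. 1)"
    using finB finA by (rule sum.swap_restrict)
  also have "\<dots> = (\<Sum>e\<in>?A. card {f \<in> ?B. e \<in> adh_edge G T X f})"
    by simp
  also have "\<dots> \<le> (\<Sum>e\<in>?A. 2)"
    by (intro sum_mono card_crossing_bold_star_le_2 assms)
  finally show ?thesis
    by simp
qed

theorem theorem3p4:
  fixes G :: "('v, 'e) mgraph" and T :: "('t, 'f) mgraph" and X :: "'t \<Rightarrow> 'v set"
  assumes "finite_mgraph G"
    and "tree_cut_decomposition G T X"
  shows "(\<forall>k. gprtw_width G T X = k \<longrightarrow> adhesion_width G T X \<le> k\<^sup>2 \<and> bag_width T X \<le> k) \<and>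
    (\<forall>a b. adhesion_width G T X = a \<and> bag_width T X = b \<longrightarrow> gprtw_width G T X \<le> a + b + 2)"
proof -
  have tree: "is_tree T"
    using assms(2) by (simp add: tree_cut_decomposition_def)
  then have fin: "finite (verts T)" "finite (edges T)" and ne: "verts T \<noteq> {}"
    and ends: "\<And>f. f \<in> edges T \<Longrightarrow> ends T f \<subseteq> verts T \<and> card (ends T f) = 2"
    by (auto simp: is_tree_def finite_mgraph_def connected_mgraph_def)
  let ?k = "gprtw_width G T X" and ?a = "adhesion_width G T X" and ?b = "bag_width T X"
  have adh_k: "card (adh_edge G T X f) \<le> ?k" if "f \<in> edges T" for f
    using fin that by (auto simp: gprtw_width_def intro!: Max_ge)
  have node_k: "card (X t) + card (bold_star G T X t) \<le> ?k" if "t \<in> verts T" for t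
    using fin that by (auto simp: gprtw_width_def simp flip: node_weight_eq[OF tree] intro!: Max_ge)
  have node_a: "card (adh_node G T X t) \<le> ?a" if "t \<in> verts T" for t
    using fin that by (auto simp: adhesion_width_def intro!: Max_ge)
  have node_b: "card (X t) \<le> ?b" if "t \<in> verts T" for t
    using fin that by (auto simp: bag_width_def intro!: Max_ge)
  have "card (adh_node G T X t) \<le> ?k\<^sup>2" if t: "t \<in> verts T" for t
  proof -
    have "card (adh_node G T X t) \<le> (\<Sum>f\<in>bold_star G T X t. card (adh_edge G T X f))"
      unfolding adh_node_eq_UN by (rule card_UN_le[OF finite_bold_star[OF tree]])
    also have "\<dots> \<le> (\<Sum>f\<in>bold_star G T X t. ?k)"
      by (intro sum_mono adh_k) (simp add: bold_star_def)
    \<comment> \<open>The number of summands is part of the weight of \<open>t\<close>, hence at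
      most \<open>?k\<close>.\<close>
    also have "\<dots> \<le> ?k * ?k"
      using node_k[OF t] by simp
    finally show ?thesis
      by (simp add: power2_eq_square)
  qed
  then have "?a \<le> ?k\<^sup>2"
    using fin ne by (auto simp: adhesion_width_def)
  moreover have "?b \<le> ?k"
    using fin ne by (auto simp: bag_width_def dest: node_k)
  moreover have "?k \<le> ?a + ?b + 2"
  proof -
    \<comment> \<open>A bold edge contributes to \<open>adh_node\<close> at either of its ends, so
      \<open>?a\<close> bounds it. A thin edge has adhesion of size at most 2, which the constant 2
      absorbs.\<close>
    have "card (adh_edge G T X f) \<le> ?a + ?b + 2" if f: "f \<in> edges T" for f
    proof (cases "bold G T X f")
      case True
      obtain t where t: "t \<in> ends T f" "t \<in> verts T"
        using ends[OF f] by (auto simp: card_2_iff)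
      have "adh_edge G T X f \<subseteq> adh_node G T X t"
        using f t True by (auto simp: adh_node_def)
      moreover have "finite (adh_node G T X t)"
        using assms(1) by (rule finite_adh_node)
      ultimately have "card (adh_edge G T X f) \<le> card (adh_node G T X t)"
        by (rule card_mono[rotated])
      then show ?thesis
        using node_a[OF t(2)] by linarith
    qed (simp add: bold_def)
    \<comment> \<open>With \<open>m\<close> bold edges at \<open>t\<close>, the inequality
      \<open>3 * m \<le> 2 * ?a\<close> gives \<open>m \<le> ?a\<close>, and the bag adds at most
      \<open>?b\<close>.\<close>
    moreover have "node_weight G T X t \<le> ?a + ?b + 2" if t: "t \<in> verts T" for t
      using card_bold_star_le[OF assms t] node_a[OF t] node_b[OF t]
      by (simp add: node_weight_eq[OF tree])
    ultimately show ?thesis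
      unfolding gprtw_width_def using fin ne by (subst Max_le_iff) auto
  qed
  ultimately show ?thesis
    by blast
qed

end
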